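(* Let $k\ge 1$ be a real number, and let $\{\alpha_n\}_{n\ge 0}$ and $\{\phi_n\}_{n\ge 0}$ be sequences of positive numbers. Set $X_0=0$ and $X_n=\dfrac{1}{n\phi_n}$ for $n=1,2,\dots$. Let $A=(a_{nv})_{n,v\ge 0}$ be a lower triangular matrix belonging to the class $\mathcal{S}(\alpha_n,\phi_n)$ (for this $k$). Let $\{\lambda_n\}_{n\ge 0}$ be a sequence of complex numbers of bounded variation, $\{\lambda_n\}\in BV$, such that $\lambda_{n+1}=O(|\lambda_n|)$ for $n=1,2,\dots$, and suppose that (A) $\sum_{n=0}^{\infty}\alpha_n\phi_n^{k}X_n^{k}|\lambda_n|^{k}<\infty$, (B) $\sum_{n=0}^{\infty}\alpha_n\phi_n^{k-1}X_n^{k}|\Delta\lambda_n|<\infty$. Suppose moreover that $$\sum_{v=0}^{n}\left|\widehat{a}_{n,v+1}\,\phi_v\right|=O(\phi_n)\qquad\text{and}\qquad \Delta X_n=O(n^{-1}),\ n=1,2,\dots.$$ Then the summability $|A,\alpha_n|_k$ of the series $\sum C_n(t)\lambda_nX_n$ at any point is a local property of $f$.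
   Context: Differences: $\Delta u_n=u_n-u_{n+1}$ and $\Delta_i\widehat a_{ni}=\widehat a_{ni}-\widehat a_{n,i+1}$ (only absolute values of these are used). $\{\lambda_n\}\in BV$ means $\sum_{n=1}^\infty|\Delta\lambda_n|<\infty$. All $O$-constants are uniform in the free indices. Associated matrices: for a lower triangular matrix $A=(a_{nv})_{n,v\ge0}$, put $\overline a_{nv}=\sum_{r=v}^{n}a_{nr}$ for $0\le v\le n$, $\widehat a_{nv}=\overline a_{nv}-\overline a_{n-1,v}$ for $0\le v\le n-1$, $n\ge1$, and $\widehat a_{nn}=a_{nn}$; entries above the diagonal are $0$ (in particular $\widehat a_{n,n+1}=0$). Summability: for a nonnegative sequence $\{\alpha_n\}$ and $k\ge1$, a series $\sum u_n$ with partial sums $s_n$ is summable $|A,\alpha_n|_k$ if $\sum_{n=1}^\infty\alpha_n|A_n-A_{n-1}|^k<\infty$, where $A_n=\sum_{v=1}^n a_{nv}s_v$ (the series considered here have zero $0$th term, so $s_0=0$ and $A_0=0$). Class $\mathcal S(\alpha_n,\phi_n)$ (for fixed $k\ge 1$): a lower triangular matrix $A$ belongs to $\mathcal{S}(\alpha_n,\phi_n)$ if (T1) $\sum_{i=0}^{n-1}|\Delta_i\widehat a_{ni}|=O(\phi_n)$; (T2) $|\widehat a_{ni}|=O(\phi_n)$ for $i=0,1,\dots,n$; (T3) $\sum_{n=i+1}^\infty\alpha_n\phi_n^{k-1}|\Delta_i\widehat a_{ni}|=O(\alpha_i\phi_i^k)$; (T4) $\sum_{n=i+1}^\infty\alpha_n\phi_n^{k-1}|\widehat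 a_{n,i+1}|=O(\alpha_i\phi_i^{k-1})$. Fourier series: $f$ is a $2\pi$-periodic function, Lebesgue integrable over $(-\pi,\pi)$, with $\int_{-\pi}^{\pi}f(t)\,dt=0$, and Fourier series $f(t)\sim\sum_{n=1}^\infty(a_n\cos nt+b_n\sin nt)\equiv\sum_{n=1}^\infty C_n(t)$. Local property: the summability of the factored series at $t=x$ is a local property of $f$ if it depends only on the behaviour of $f$ in an arbitrarily small neighbourhood of $x$; i.e. if two such functions $f,g$ coincide in some neighbourhood of $x$, then the series built from $f$ is summable at $x$ if and only if the one built from $g$ is. *)

theory Defs
  imports "HOL-Analysis.Analysis"
begin

definition fdiff :: "(nat \<Rightarrow> 'a::ab_group_add) \<Rightarrow> nat \<Rightarrow> 'a" where
  "fdiff u n = u n - u (Suc n)"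

definition lower_triangular :: "(nat \<Rightarrow> nat \<Rightarrow> 'a::zero) \<Rightarrow> bool" where
  "lower_triangular A \<longleftrightarrow> (\<forall>n v. n < v \<longrightarrow> A n v = 0)"

(* The sum is empty, so the entry is 0, above the diagonal. *)
definition mat_bar :: "(nat \<Rightarrow> nat \<Rightarrow> complex) \<Rightarrow> nat \<Rightarrow> nat \<Rightarrow> complex" where
  "mat_bar A n v = (\<Sum>r = v..n. A n r)"

definition mat_hat :: "(nat \<Rightarrow> nat \<Rightarrow> complex) \<Rightarrow> nat \<Rightarrow> nat \<Rightarrow> complex" where
  "mat_hat A n v =
     (if v < n then mat_bar A n v - mat_bar A (n - 1) v
      else if v = n then A n n
      else 0)"

(* A series is given by its terms u 1, u 2, ...; the value u 0 is ignored. *)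
definition mat_mean :: "(nat \<Rightarrow> nat \<Rightarrow> complex) \<Rightarrow> (nat \<Rightarrow> complex) \<Rightarrow> nat \<Rightarrow> complex" where
  "mat_mean A u n = (\<Sum>v = 1..n. A n v * (\<Sum>r = 1..v. u r))"

definition abs_mat_summable ::
  "(nat \<Rightarrow> nat \<Rightarrow> complex) \<Rightarrow> (nat \<Rightarrow> real) \<Rightarrow> real \<Rightarrow> (nat \<Rightarrow> complex) \<Rightarrow> bool" where
  "abs_mat_summable A \<alpha> k u \<longleftrightarrow>
     (\<lambda>n. \<alpha> n * norm (mat_mean A u n - mat_mean A u (n - 1)) powr k) summable_on {1..}"

(* An infinite sum being O(...) includes its convergence. *)
definition class_S ::
  "real \<Rightarrow> (nat \<Rightarrow> real) \<Rightarrow> (nat \<Rightarrow> real) \<Rightarrow> (nat \<Rightarrow> nat \<Rightarrow> complex) set" where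
  "class_S k \<alpha> \<phi> = {A. lower_triangular A \<and>
     (\<exists>K. \<forall>n. (\<Sum>i<n. norm (fdiff (mat_hat A n) i)) \<le> K * \<phi> n) \<and>
     (\<exists>K. \<forall>n. \<forall>i\<le>n. norm (mat_hat A n i) \<le> K * \<phi> n) \<and>
     (\<exists>K. \<forall>i.
        (\<lambda>n. \<alpha> n * \<phi> n powr (k - 1) * norm (fdiff (mat_hat A n) i)) summable_on {i+1..} \<and>
        (\<Sum>\<^sub>\<infinity>n\<in>{i+1..}. \<alpha> n * \<phi> n powr (k - 1) * norm (fdiff (mat_hat A n) i))
          \<le> K * (\<alpha> i * \<phi> i powr k)) \<and>
     (\<exists>K. \<forall>i.
        (\<lambda>n. \<alpha> n * \<phi> n powr (k - 1) * norm (mat_hat A n (i+1))) summable_on {i+1..} \<and>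
        (\<Sum>\<^sub>\<infinity>n\<in>{i+1..}. \<alpha> n * \<phi> n powr (k - 1) * norm (mat_hat A n (i+1)))
          \<le> K * (\<alpha> i * \<phi> i powr (k - 1)))}"

definition periodic_mean_zero :: "(real \<Rightarrow> complex) \<Rightarrow> bool" where
  "periodic_mean_zero f \<longleftrightarrow>
     (\<forall>t. f (t + 2 * pi) = f t) \<and>
     set_integrable lebesgue {-pi<..<pi} f \<and>
     (LINT t:{-pi<..<pi}|lebesgue. f t) = 0"

definition fourier_cos_coeff :: "(real \<Rightarrow> complex) \<Rightarrow> nat \<Rightarrow> complex" where
  "fourier_cos_coeff f n =
     of_real (1 / pi) * (LINT t:{-pi<..<pi}|lebesgue. f t * of_real (cos (real n * t)))"

definition fourier_sin_coeff :: "(real \<Rightarrow> complex) \<Rightarrow> nat \<Rightarrow> complex" where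
  "fourier_sin_coeff f n =
     of_real (1 / pi) * (LINT t:{-pi<..<pi}|lebesgue. f t * of_real (sin (real n * t)))"

definition fourier_term :: "(real \<Rightarrow> complex) \<Rightarrow> nat \<Rightarrow> real \<Rightarrow> complex" where
  "fourier_term f n t =
     fourier_cos_coeff f n * of_real (cos (real n * t)) +
     fourier_sin_coeff f n * of_real (sin (real n * t))"

definition local_property_at :: "((real \<Rightarrow> complex) \<Rightarrow> bool) \<Rightarrow> real \<Rightarrow> bool" where
  "local_property_at P x \<longleftrightarrow>
     (\<forall>f g. periodic_mean_zero f \<longrightarrow> periodic_mean_zero g \<longrightarrow>
        (\<forall>\<^sub>F t in nhds x. f t = g t) \<longrightarrow> (P f \<longleftrightarrow> P g))"

end

theory Submission
  imports Defs
begin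

text \<open>
  Let \<open>f\<close> and \<open>g\<close> agree near \<open>x\<close>. Everything in sight is linear in the function, so the matter
  comes down to \<open>h = f - g\<close>, which vanishes near \<open>x\<close>. Away from the multiples of \<open>2 * pi\<close> the Dirichlet
  kernels are uniformly bounded; hence the partial sums of the Fourier series of \<open>h\<close> at \<open>x\<close> are
  bounded (lemma \<open>fourier_partial_sums_bounded\<close>). It remains to see that the factors
  \<open>\<lambda>\<^sub>n X\<^sub>n\<close> turn every series with bounded partial sums \<open>s\<^sub>n\<close> into an absolutely summable one
  (lemma \<open>abs_mat_summable_of_bounded_partial_sums\<close>).

  For this, \<open>A\<^sub>n - A\<^bsub>n-1\<^esub>\<close> is the \<open>n\<close>-th row of the matrix \<open>mat_hat A\<close> applied to the terms of the series.
  Abel summation moves the difference onto the product of the row, of \<open>\<lambda>\<close> and of \<open>X\<close>,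
  and the product rule for differences yields three sums and a diagonal term. In the third sum,
  \<open>\<Delta>X\<^sub>r = O(1/r)\<close> enters in the form \<open>1/r = \<phi>\<^sub>r X\<^sub>r\<close>, and \<open>\<lambda>\<^bsub>r+1\<^esub> = O(\<lambda>\<^sub>r)\<close>.
  Each of the three sums has the form \<open>\<Sum>\<^sub>r w\<^bsub>nr\<^esub> y\<^sub>r\<close> with row sums of \<open>w\<close> of size \<open>O(\<phi>\<^sub>n)\<close> and weighted
  column sums controlled by the conditions on the matrix, and is treated by one estimate
  (lemma \<open>weighted_lk_row_sums\<close>): Hoelder's inequality on each row, then an interchange of
  summation. The weights \<open>w\<^bsub>nr\<^esub>\<close> are respectively \<open>|\<Delta>\<^sub>r a\<^bsub>nr\<^esub>|\<close>, \<open>|a\<^bsub>n,r+1\<^esub>| |\<Delta>\<lambda>\<^sub>r|\<close> and \<open>|a\<^bsub>n,r+1\<^esub>| \<phi>\<^sub>r\<close>,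
  where \<open>a\<close> stands for \<open>mat_hat A\<close>; they lead to the hypotheses (A), (B) and (A) again.
\<close>

section \<open>Weighted power summability\<close>

definition weighted_lk :: "(nat \<Rightarrow> real) \<Rightarrow> real \<Rightarrow> (nat \<Rightarrow> real) \<Rightarrow> bool" where
  "weighted_lk \<alpha> k p \<longleftrightarrow> (\<lambda>n. \<alpha> n * p n powr k) summable_on {1..}"

lemma weighted_lk_mono:
  assumes "weighted_lk \<alpha> k q" "k \<ge> 0" "\<And>n. \<alpha> n \<ge> 0"
    and "\<And>n. n \<ge> 1 \<Longrightarrow> 0 \<le> p n" "\<And>n. n \<ge> 1 \<Longrightarrow> p n \<le> q n"
  shows "weighted_lk \<alpha> k p"
  unfolding weighted_lk_def
proof (rule summable_on_comparison_test)
  show "(\<lambda>n. \<alpha> n * q n powr k) summable_on {1..}"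
    using assms(1) by (simp add: weighted_lk_def)
qed (use assms in \<open>auto intro!: mult_left_mono powr_mono2\<close>)

lemma weighted_lk_cmult:
  assumes "weighted_lk \<alpha> k p" "M \<ge> 0" "\<And>n. p n \<ge> 0"
  shows "weighted_lk \<alpha> k (\<lambda>n. M * p n)"
proof -
  have "(\<lambda>n. M powr k * (\<alpha> n * p n powr k)) summable_on {1..}"
    using assms(1) unfolding weighted_lk_def by (rule summable_on_cmult_right)
  then show ?thesis
    using assms by (simp add: weighted_lk_def powr_mult mult_ac)
qed

lemma weighted_lk_add:
  assumes "weighted_lk \<alpha> k p" "weighted_lk \<alpha> k q" "k \<ge> 0" "\<And>n. \<alpha> n \<ge> 0"
    and "\<And>n. p n \<ge> 0" "\<And>n. q n \<ge> 0"
  shows "weighted_lk \<alpha> k (\<lambda>n. p n + q n)"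
proof -
  have pointwise: "(a + b) powr k \<le> 2 powr k * (a powr k + b powr k)"
    if "a \<ge> 0" "b \<ge> 0" for a b :: real
  proof -
    have "(a + b) powr k \<le> (2 * max a b) powr k"
      using that assms(3) by (intro powr_mono2) auto
    also have "\<dots> = 2 powr k * max a b powr k"
      using that by (simp add: powr_mult)
    also have "\<dots> \<le> 2 powr k * (a powr k + b powr k)"
      by (intro mult_left_mono) (auto simp: max_def)
    finally show ?thesis .
  qed
  have "(\<lambda>n. 2 powr k * (\<alpha> n * p n powr k + \<alpha> n * q n powr k)) summable_on {1..}"
    using assms(1,2) unfolding weighted_lk_def
    by (intro summable_on_cmult_right summable_on_add)
  then show ?thesis
    unfolding weighted_lk_def
  proof (rule summable_on_comparison_test)
    fix n :: nat
    have "\<alpha> n * (p n + q n) powr k \<le> \<alpha> n * (2 powr k * (p n powr k + q n powr k))"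
      using assms pointwise by (intro mult_left_mono) auto
    then show "\<alpha> n * (p n + q n) powr k \<le> 2 powr k * (\<alpha> n * p n powr k + \<alpha> n * q n powr k)"
      by (simp add: algebra_simps)
  qed (use assms in auto)
qed

text \<open>
  Hoelder's inequality in the form of Jensen's inequality for \<open>t\<^sup>k\<close>, with a bound on the total
  weight in place of a normalisation.
\<close>

lemma powr_weighted_sum_le:
  fixes w y :: "'a \<Rightarrow> real"
  assumes "finite S" "k \<ge> 1" "\<And>i. i \<in> S \<Longrightarrow> w i \<ge> 0" "\<And>i. i \<in> S \<Longrightarrow> y i \<ge> 0"
    and "(\<Sum>i\<in>S. w i) \<le> B"
  shows "(\<Sum>i\<in>S. w i * y i) powr k \<le> B powr (k - 1) * (\<Sum>i\<in>S. w i * y i powr k)"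
proof -
  \<comment> \<open>Convexity of \<open>t\<^sup>k\<close> is available on the open half-line; indices with \<open>y i = 0\<close> contribute nothing.\<close>
  define T where "T = {i \<in> S. y i > 0}"
  define W where "W = (\<Sum>i\<in>T. w i)"
  have T: "finite T" "T \<subseteq> S" "\<And>i. i \<in> T \<Longrightarrow> w i \<ge> 0" "\<And>i. i \<in> T \<Longrightarrow> y i > 0"
    using assms by (auto simp: T_def)
  have off_T: "y i = 0" if "i \<in> S - T" for i
    using that assms(4)[of i] by (auto simp: T_def)
  have sum_T: "(\<Sum>i\<in>S. w i * y i) = (\<Sum>i\<in>T. w i * y i)"
    "(\<Sum>i\<in>S. w i * y i powr k) = (\<Sum>i\<in>T. w i * y i powr k)"
    using assms(1) T(2) off_T by (auto intro!: sum.mono_neutral_right)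
  have "W \<le> (\<Sum>i\<in>S. w i)"
    unfolding W_def using assms T by (intro sum_mono2) auto
  with assms(5) have W_le: "W \<le> B" by simp
  have W_nonneg: "W \<ge> 0"
    unfolding W_def using T by (intro sum_nonneg) auto
  have rhs_nonneg: "(\<Sum>i\<in>T. w i * y i powr k) \<ge> 0"
    using T by (intro sum_nonneg) auto
  have "(\<Sum>i\<in>T. w i * y i) powr k \<le> W powr (k - 1) * (\<Sum>i\<in>T. w i * y i powr k)"
  proof (cases "W = 0")
    case True
    then have "\<forall>i\<in>T. w i = 0"
      using T sum_nonneg_eq_0_iff[of T w] by (simp add: W_def)
    then show ?thesis by simp
  next
    case False
    with W_nonneg have "W > 0" by simp
    define z where "z = (\<Sum>i\<in>T. (w i / W) *\<^sub>R y i)"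
    have "T \<noteq> {}" using False by (auto simp: W_def)
    have "z powr k \<le> (\<Sum>i\<in>T. w i / W * y i powr k)"
      unfolding z_def
    proof (rule convex_on_sum[OF T(1) \<open>T \<noteq> {}\<close> powr_convex[OF assms(2)]])
      show "(\<Sum>i\<in>T. w i / W) = 1"
        using False by (simp add: W_def flip: sum_divide_distrib)
    qed (use T W_nonneg in auto)
    then have jensen: "z powr k \<le> (\<Sum>i\<in>T. w i * y i powr k) / W"
      by (simp add: sum_divide_distrib)
    have "z \<ge> 0"
      unfolding z_def using T W_nonneg by (intro sum_nonneg) (auto simp: less_imp_le)
    have "(\<Sum>i\<in>T. w i * y i) = W * z"
      using False by (simp add: z_def sum_distrib_left)
    then have "(\<Sum>i\<in>T. w i * y i) powr k = W powr k * z powr k"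
      using \<open>z \<ge> 0\<close> W_nonneg by (simp add: powr_mult)
    also have "\<dots> \<le> W powr k * ((\<Sum>i\<in>T. w i * y i powr k) / W)"
      using jensen by (intro mult_left_mono) auto
    also have "\<dots> = W powr (k - 1) * (\<Sum>i\<in>T. w i * y i powr k)"
      using \<open>W > 0\<close> by (simp add: powr_diff)
    finally show ?thesis .
  qed
  also have "\<dots> \<le> B powr (k - 1) * (\<Sum>i\<in>T. w i * y i powr k)"
    using W_le W_nonneg assms(2) rhs_nonneg by (intro mult_right_mono powr_mono2) auto
  finally show ?thesis by (simp add: sum_T)
qed

text \<open>
  Hoelder's inequality on the \<open>n\<close>-th row, whose total weight is \<open>O(\<phi>\<^sub>n)\<close>, costs the factor \<open>\<phi>\<^sub>n\<^bsup>k-1\<^esup>\<close>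
  and leaves \<open>\<Sum>\<^sub>r w\<^bsub>nr\<^esub> y\<^sub>r\<^sup>k\<close>. As all terms are nonnegative, the order of summation can be changed,
  and the inner sums over \<open>n\<close> are then exactly the ones that the column hypothesis bounds.
\<close>

lemma weighted_lk_row_sums:
  fixes w :: "nat \<Rightarrow> nat \<Rightarrow> real" and \<alpha> \<phi> y c :: "nat \<Rightarrow> real"
  assumes "k \<ge> 1" "\<And>n. \<alpha> n \<ge> 0" "\<And>n. \<phi> n \<ge> 0" "\<And>n r. w n r \<ge> 0" "\<And>r. y r \<ge> 0"
    and "\<And>r. c r \<ge> 0" "B \<ge> 0" "L \<ge> 0"
    and row: "\<And>n. (\<Sum>r\<in>{1..<n}. w n r) \<le> B * \<phi> n"
    and col_summable: "\<And>r. (\<lambda>n. \<alpha> n * \<phi> n powr (k - 1) * w n r) summable_on {r+1..}"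
    and col: "\<And>r. (\<Sum>\<^sub>\<infinity>n\<in>{r+1..}. \<alpha> n * \<phi> n powr (k - 1) * w n r) \<le> L * c r"
    and cy: "(\<lambda>r. c r * y r powr k) summable_on UNIV"
  shows "weighted_lk \<alpha> k (\<lambda>n. \<Sum>r\<in>{1..<n}. w n r * y r)"
  unfolding weighted_lk_def
proof (rule nonneg_bdd_above_summable_on)
  define C where "C = B powr (k - 1) * (L * (\<Sum>\<^sub>\<infinity>r. c r * y r powr k))"
  define g where "g n r = \<alpha> n * \<phi> n powr (k - 1) * w n r" for n r
  have g_nonneg: "g n r \<ge> 0" for n r
    using assms by (simp add: g_def)
  have row_bound: "\<alpha> n * (\<Sum>r\<in>{1..<n}. w n r * y r) powr k
      \<le> B powr (k - 1) * (\<Sum>r\<in>{1..<n}. g n r * y r powr k)" for n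
  proof -
    have "\<alpha> n * (\<Sum>r\<in>{1..<n}. w n r * y r) powr k
        \<le> \<alpha> n * ((B * \<phi> n) powr (k - 1) * (\<Sum>r\<in>{1..<n}. w n r * y r powr k))"
      using assms by (intro mult_left_mono powr_weighted_sum_le) auto
    also have "\<dots> = B powr (k - 1) * (\<Sum>r\<in>{1..<n}. g n r * y r powr k)"
      using assms by (simp add: g_def powr_mult sum_distrib_left mult_ac)
    finally show ?thesis .
  qed
  have "sum (\<lambda>n. \<alpha> n * (\<Sum>r\<in>{1..<n}. w n r * y r) powr k) F \<le> C"
    if F: "finite F" for F :: "nat set"
  proof -
    define R where "R = {1..<Suc (Max (insert 0 F))}"
    have R: "{r \<in> R. r < n} = {1..<n}" if "n \<in> F" for n
    proof -
      have "n \<le> Max (insert 0 F)" using that F by (intro Max_ge) auto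
      then show ?thesis by (auto simp: R_def simp del: Max_insert)
    qed
    have column: "(\<Sum>n\<in>{n \<in> F. r < n}. g n r) \<le> L * c r" for r
    proof -
      have "(\<Sum>n\<in>{n \<in> F. r < n}. g n r) \<le> (\<Sum>\<^sub>\<infinity>n\<in>{r+1..}. g n r)"
        using col_summable[of r] g_nonneg F
        by (intro finite_sum_le_infsum) (auto simp: g_def)
      also have "\<dots> \<le> L * c r" using col[of r] by (simp add: g_def)
      finally show ?thesis .
    qed
    have "sum (\<lambda>n. \<alpha> n * (\<Sum>r\<in>{1..<n}. w n r * y r) powr k) F
        \<le> (\<Sum>n\<in>F. B powr (k - 1) * (\<Sum>r\<in>{1..<n}. g n r * y r powr k))"
      by (intro sum_mono row_bound)
    also have "\<dots> = B powr (k - 1) * (\<Sum>n\<in>F. \<Sum>r\<in>{r \<in> R. r < n}. g n r * y r powr k)"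
      using R by (simp add: sum_distrib_left)
    also have "(\<Sum>n\<in>F. \<Sum>r\<in>{r \<in> R. r < n}. g n r * y r powr k)
        = (\<Sum>r\<in>R. \<Sum>n\<in>{n \<in> F. r < n}. g n r * y r powr k)"
      using F by (intro sum.swap_restrict) (auto simp: R_def)
    also have "\<dots> = (\<Sum>r\<in>R. (\<Sum>n\<in>{n \<in> F. r < n}. g n r) * y r powr k)"
      by (simp add: sum_distrib_right)
    also have "\<dots> \<le> (\<Sum>r\<in>R. L * c r * y r powr k)"
      by (intro sum_mono mult_right_mono column) auto
    also have "\<dots> = L * (\<Sum>r\<in>R. c r * y r powr k)"
      by (simp add: sum_distrib_left mult_ac)
    also have "\<dots> \<le> L * (\<Sum>\<^sub>\<infinity>r. c r * y r powr k)"
      using assms by (intro mult_left_mono finite_sum_le_infsum[OF cy]) (auto simp: R_def)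
    finally show ?thesis
      by (simp add: C_def mult_left_mono)
  qed
  then show "bdd_above (sum (\<lambda>n. \<alpha> n * (\<Sum>r\<in>{1..<n}. w n r * y r) powr k)
      ` {F. F \<subseteq> {1..} \<and> finite F})"
    by (intro bdd_aboveI2[where M = C]) auto
qed (use assms in auto)

section \<open>Matrix means of factored series\<close>

lemma mat_mean_eq_bar: "mat_mean A u n = (\<Sum>r = 1..n. mat_bar A n r * u r)"
proof -
  have "mat_mean A u n = (\<Sum>v\<in>{1..n}. \<Sum>r\<in>{r \<in> {1..n}. r \<le> v}. A n v * u r)"
    unfolding mat_mean_def sum_distrib_left
    by (intro sum.cong refl) auto
  also have "\<dots> = (\<Sum>r\<in>{1..n}. \<Sum>v\<in>{v \<in> {1..n}. r \<le> v}. A n v * u r)"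
    by (rule sum.swap_restrict) auto
  also have "\<dots> = (\<Sum>r = 1..n. mat_bar A n r * u r)"
    unfolding mat_bar_def sum_distrib_right
    by (intro sum.cong refl) auto
  finally show ?thesis .
qed

lemma mat_mean_diff_eq_hat:
  assumes "n \<ge> 1"
  shows "mat_mean A u n - mat_mean A u (n - 1) = (\<Sum>r = 1..n. mat_hat A n r * u r)"
proof -
  have split: "{1..n} = insert n {1..<n}" "{1..n - 1} = {1..<n}"
    using assms by auto
  have "(\<Sum>r = 1..n. mat_hat A n r * u r)
      = A n n * u n + (\<Sum>r\<in>{1..<n}. (mat_bar A n r - mat_bar A (n - 1) r) * u r)"
    unfolding split by (simp add: mat_hat_def)
  also have "\<dots> = mat_bar A n n * u n + (\<Sum>r\<in>{1..<n}. mat_bar A n r * u r)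
      - (\<Sum>r\<in>{1..<n}. mat_bar A (n - 1) r * u r)"
    by (simp add: mat_bar_def algebra_simps sum_subtractf)
  finally show ?thesis
    unfolding mat_mean_eq_bar split by simp
qed

lemma abs_mat_summable_iff_weighted_lk:
  "abs_mat_summable A \<alpha> k u \<longleftrightarrow>
     weighted_lk \<alpha> k (\<lambda>n. norm (mat_mean A u n - mat_mean A u (n - 1)))"
  by (simp add: abs_mat_summable_def weighted_lk_def)

lemma abs_mat_summable_add:
  assumes "abs_mat_summable A \<alpha> k u" "abs_mat_summable A \<alpha> k v" "k \<ge> 0" "\<And>n. \<alpha> n \<ge> 0"
  shows "abs_mat_summable A \<alpha> k (\<lambda>n. u n + v n)"
proof -
  have mean_add: "mat_mean A (\<lambda>n. u n + v n) n = mat_mean A u n + mat_mean A v n" for n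
    by (simp add: mat_mean_def sum.distrib algebra_simps)
  have "weighted_lk \<alpha> k (\<lambda>n. norm (mat_mean A u n - mat_mean A u (n - 1))
      + norm (mat_mean A v n - mat_mean A v (n - 1)))"
    using assms by (intro weighted_lk_add) (auto simp: abs_mat_summable_iff_weighted_lk)
  then show ?thesis
    unfolding abs_mat_summable_iff_weighted_lk
  proof (rule weighted_lk_mono)
    fix n
    show "norm (mat_mean A (\<lambda>n. u n + v n) n - mat_mean A (\<lambda>n. u n + v n) (n - 1))
      \<le> norm (mat_mean A u n - mat_mean A u (n - 1)) + norm (mat_mean A v n - mat_mean A v (n - 1))"
      unfolding mean_add
      using norm_triangle_ineq[of "mat_mean A u n - mat_mean A u (n - 1)"
          "mat_mean A v n - mat_mean A v (n - 1)"]
      by (simp add: algebra_simps)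
  qed (use assms in auto)
qed

lemma abel_summation:
  fixes b c :: "nat \<Rightarrow> 'a::comm_ring"
  assumes "n \<ge> 1"
  shows "(\<Sum>r = 1..n. b r * c r)
    = (\<Sum>r\<in>{1..<n}. fdiff b r * (\<Sum>i = 1..r. c i)) + b n * (\<Sum>i = 1..n. c i)"
  using assms
proof (induction n rule: nat_induct_at_least)
  case base
  then show ?case by simp
next
  case (Suc n)
  have "{1..<Suc n} = insert n {1..<n}" using Suc.hyps by auto
  then show ?case
    using Suc by (simp add: fdiff_def algebra_simps)
qed

lemma fdiff_mult3:
  fixes a l x :: "nat \<Rightarrow> 'a::comm_ring"
  shows "fdiff (\<lambda>r. a r * l r * x r) r
    = fdiff a r * l r * x r + a (Suc r) * fdiff l r * x r + a (Suc r) * l (Suc r) * fdiff x r"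
  by (simp add: fdiff_def algebra_simps)

text \<open>
  The pointwise estimate behind the theorem. The bound on \<open>fdiff x\<close> is kept relative to \<open>\<phi> * x\<close>, so
  that the last sum can use the row bound on \<open>norm (a (r + 1)) * \<phi> r\<close>.
\<close>

lemma norm_factored_sum_le:
  fixes a l c :: "nat \<Rightarrow> complex" and x \<phi> :: "nat \<Rightarrow> real"
  assumes "n \<ge> 1" "D \<ge> 0" "E \<ge> 0"
    and x: "\<And>r. x r \<ge> 0"
    and c: "\<And>r. norm (\<Sum>i = 1..r. c i) \<le> M"
    and l: "\<And>r. r \<ge> 1 \<Longrightarrow> norm (l (Suc r)) \<le> D * norm (l r)"
    and dx: "\<And>r. r \<ge> 1 \<Longrightarrow> \<bar>fdiff x r\<bar> \<le> E * (\<phi> r * x r)"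
  shows "norm (\<Sum>r = 1..n. a r * (c r * l r * of_real (x r)))
    \<le> M * ((\<Sum>r\<in>{1..<n}. norm (fdiff a r) * (norm (l r) * x r))
          + (\<Sum>r\<in>{1..<n}. norm (a (r + 1)) * norm (fdiff l r) * x r)
          + D * E * (\<Sum>r\<in>{1..<n}. norm (a (r + 1)) * \<phi> r * (norm (l r) * x r))
          + norm (a n) * (norm (l n) * x n))"
proof -
  define b where "b r = a r * l r * of_real (x r)" for r
  define s where "s r = (\<Sum>i = 1..r. c i)" for r
  have s: "norm (s r) \<le> M" for r using c by (simp add: s_def)
  then have M: "M \<ge> 0" using norm_ge_zero order_trans by blast
  have "(\<Sum>r = 1..n. a r * (c r * l r * of_real (x r))) = (\<Sum>r = 1..n. b r * c r)"
    by (simp add: b_def mult_ac)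
  also have "\<dots> = (\<Sum>r\<in>{1..<n}. fdiff b r * s r) + b n * s n"
    unfolding s_def by (rule abel_summation[OF assms(1)])
  finally have "norm (\<Sum>r = 1..n. a r * (c r * l r * of_real (x r)))
      \<le> norm (\<Sum>r\<in>{1..<n}. fdiff b r * s r) + norm (b n * s n)"
    by (simp add: norm_triangle_ineq)
  also have "\<dots> \<le> (\<Sum>r\<in>{1..<n}. norm (fdiff b r) * M) + norm (b n) * M"
    by (intro add_mono sum_norm_le) (auto simp: norm_mult intro!: mult_left_mono s)
  also have "\<dots> = M * ((\<Sum>r\<in>{1..<n}. norm (fdiff b r)) + norm (b n))"
    by (simp add: sum_distrib_left sum_distrib_right algebra_simps)
  finally have "norm (\<Sum>r = 1..n. a r * (c r * l r * of_real (x r)))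
      \<le> M * ((\<Sum>r\<in>{1..<n}. norm (fdiff b r)) + norm (b n))" .
  moreover have "(\<Sum>r\<in>{1..<n}. norm (fdiff b r)) \<le> (\<Sum>r\<in>{1..<n}.
      norm (fdiff a r) * (norm (l r) * x r) + norm (a (r + 1)) * norm (fdiff l r) * x r
      + D * E * (norm (a (r + 1)) * \<phi> r * (norm (l r) * x r)))"
  proof (intro sum_mono)
    fix r assume "r \<in> {1..<n}"
    then have r: "r \<ge> 1" by simp
    have diff_x: "fdiff (\<lambda>r. of_real (x r) :: complex) r = of_real (fdiff x r)"
      by (simp add: fdiff_def)
    have "norm (fdiff b r) \<le> norm (fdiff a r * l r * of_real (x r))
        + norm (a (Suc r) * fdiff l r * of_real (x r))
        + norm (a (Suc r) * l (Suc r) * of_real (fdiff x r))"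
      unfolding b_def fdiff_mult3 diff_x
      by (intro order_trans[OF norm_triangle_ineq] add_mono norm_triangle_ineq order_refl)
    also have "\<dots> = norm (fdiff a r) * (norm (l r) * x r) + norm (a (r + 1)) * norm (fdiff l r) * x r
        + norm (a (r + 1)) * (norm (l (Suc r)) * \<bar>fdiff x r\<bar>)"
      using x[of r] by (simp add: norm_mult)
    finally have "norm (fdiff b r) \<le> norm (fdiff a r) * (norm (l r) * x r)
        + norm (a (r + 1)) * norm (fdiff l r) * x r
        + norm (a (r + 1)) * (norm (l (Suc r)) * \<bar>fdiff x r\<bar>)" .
    moreover have "norm (l (Suc r)) * \<bar>fdiff x r\<bar> \<le> (D * norm (l r)) * (E * (\<phi> r * x r))"
      using l[OF r] dx[OF r] assms by (intro mult_mono) auto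
    then have "norm (a (r + 1)) * (norm (l (Suc r)) * \<bar>fdiff x r\<bar>)
        \<le> norm (a (r + 1)) * ((D * norm (l r)) * (E * (\<phi> r * x r)))"
      by (intro mult_left_mono) auto
    moreover have "norm (a (r + 1)) * ((D * norm (l r)) * (E * (\<phi> r * x r)))
        = D * E * (norm (a (r + 1)) * \<phi> r * (norm (l r) * x r))"
      by simp
    ultimately show "norm (fdiff b r) \<le> norm (fdiff a r) * (norm (l r) * x r)
        + norm (a (r + 1)) * norm (fdiff l r) * x r
        + D * E * (norm (a (r + 1)) * \<phi> r * (norm (l r) * x r))"
      by linarith
  qed
  moreover have "norm (b n) = norm (a n) * (norm (l n) * x n)"
    using x[of n] by (simp add: b_def norm_mult)
  ultimately show ?thesis
    by (elim order_trans, intro mult_left_mono M)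
      (simp add: sum.distrib sum_distrib_left)
qed

lemma nonneg_bound_constant:
  fixes p q :: "'i \<Rightarrow> real"
  assumes "\<exists>K. \<forall>i. P i \<longrightarrow> p i \<le> K * q i" "\<And>i. q i \<ge> 0"
  shows "\<exists>K\<ge>0. \<forall>i. P i \<longrightarrow> p i \<le> K * q i"
proof -
  from assms(1) obtain K where "\<And>i. P i \<Longrightarrow> p i \<le> K * q i" by blast
  then have "p i \<le> \<bar>K\<bar> * q i" if "P i" for i
    using that assms(2)[of i] by (meson abs_ge_self mult_right_mono order_trans)
  then show ?thesis by (intro exI[of _ "\<bar>K\<bar>"]) auto
qed

text \<open>
  The three sums and the diagonal term of the pointwise estimate are weighted \<open>k\<close>-summable: the first
  by (T1), (T3) and (A), the second by (T2), (T4), bounded variation and (B), the third by the row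
  bound on \<open>|a\<^bsub>n,r+1\<^esub>| \<phi>\<^sub>r\<close>, (T4) and (A), the diagonal term by (T2) and (A); here \<open>a\<close>
  stands for \<open>mat_hat A\<close>.
\<close>

lemma abs_mat_summable_of_bounded_partial_sums:
  fixes k :: real
    and \<alpha> \<phi> X :: "nat \<Rightarrow> real"
    and A :: "nat \<Rightarrow> nat \<Rightarrow> complex"
    and lam c :: "nat \<Rightarrow> complex"
  assumes k: "k \<ge> 1"
    and \<alpha>: "\<And>n. \<alpha> n > 0"
    and \<phi>: "\<And>n. \<phi> n > 0"
    and X0: "X 0 = 0"
    and X: "\<And>n. n \<ge> 1 \<Longrightarrow> X n = 1 / (real n * \<phi> n)"
    and A: "A \<in> class_S k \<alpha> \<phi>"
    and bv: "(\<lambda>n. norm (fdiff lam n)) summable_on {1..}"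
    and lam_Suc: "\<exists>K. \<forall>n\<ge>1. norm (lam (n + 1)) \<le> K * norm (lam n)"
    and sum_A: "(\<lambda>n. \<alpha> n * \<phi> n powr k * X n powr k * norm (lam n) powr k) summable_on UNIV"
    and sum_B: "(\<lambda>n. \<alpha> n * \<phi> n powr (k - 1) * X n powr k * norm (fdiff lam n)) summable_on UNIV"
    and row: "\<exists>K. \<forall>n. (\<Sum>v\<le>n. norm (mat_hat A n (v + 1) * of_real (\<phi> v))) \<le> K * \<phi> n"
    and diff_X: "\<exists>K. \<forall>n\<ge>1. \<bar>fdiff X n\<bar> \<le> K * (1 / real n)"
    and c: "\<And>n. norm (\<Sum>r = 1..n. c r) \<le> M"
  shows "abs_mat_summable A \<alpha> k (\<lambda>n. c n * lam n * of_real (X n))"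
proof -
  let ?a = "mat_hat A"
  have nonneg: "\<alpha> n \<ge> 0" "\<phi> n \<ge> 0" "X n \<ge> 0" for n
    using \<alpha>[of n] \<phi>[of n] X[of n] X0 by (cases "n = 0"; simp)+
  note bound = nonneg_bound_constant[where P = "\<lambda>_. True", simplified]
  have "\<exists>K\<ge>0. \<forall>n. (\<Sum>i<n. norm (fdiff (?a n) i)) \<le> K * \<phi> n"
    by (rule bound) (use A nonneg in \<open>auto simp: class_S_def\<close>)
  then obtain K1 where K1: "K1 \<ge> 0" "\<And>n. (\<Sum>i<n. norm (fdiff (?a n) i)) \<le> K1 * \<phi> n"
    by blast
  have "\<exists>K. \<forall>n. \<forall>i\<le>n. norm (?a n i) \<le> K * \<phi> n"
    using A by (auto simp: class_S_def)
  then have "\<exists>K\<ge>0. \<forall>j. snd j \<le> fst j \<longrightarrow> norm (?a (fst j) (snd j)) \<le> K * \<phi> (fst j)"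
    using nonneg by (intro nonneg_bound_constant) auto
  then obtain K2 where K2: "K2 \<ge> 0" "\<And>n i. i \<le> n \<Longrightarrow> norm (?a n i) \<le> K2 * \<phi> n"
    by (metis fst_conv snd_conv)
  have T3_summable: "(\<lambda>n. \<alpha> n * \<phi> n powr (k - 1) * norm (fdiff (?a n) i)) summable_on {i+1..}"
    and T4_summable: "(\<lambda>n. \<alpha> n * \<phi> n powr (k - 1) * norm (?a n (i+1))) summable_on {i+1..}" for i
    using A by (auto simp: class_S_def)
  have "\<exists>K\<ge>0. \<forall>i. (\<Sum>\<^sub>\<infinity>n\<in>{i+1..}. \<alpha> n * \<phi> n powr (k - 1) * norm (fdiff (?a n) i))
      \<le> K * (\<alpha> i * \<phi> i powr k)"
  proof (rule bound)
    show "\<exists>K. \<forall>i. (\<Sum>\<^sub>\<infinity>n\<in>{i+1..}. \<alpha> n * \<phi> n powr (k - 1) * norm (fdiff (?a n) i))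
        \<le> K * (\<alpha> i * \<phi> i powr k)"
      using A unfolding class_S_def by blast
  qed (use nonneg in auto)
  then obtain K3 where K3: "K3 \<ge> 0"
    "\<And>i. (\<Sum>\<^sub>\<infinity>n\<in>{i+1..}. \<alpha> n * \<phi> n powr (k - 1) * norm (fdiff (?a n) i))
      \<le> K3 * (\<alpha> i * \<phi> i powr k)"
    by blast
  have "\<exists>K\<ge>0. \<forall>i. (\<Sum>\<^sub>\<infinity>n\<in>{i+1..}. \<alpha> n * \<phi> n powr (k - 1) * norm (?a n (i+1)))
      \<le> K * (\<alpha> i * \<phi> i powr (k - 1))"
  proof (rule bound)
    show "\<exists>K. \<forall>i. (\<Sum>\<^sub>\<infinity>n\<in>{i+1..}. \<alpha> n * \<phi> n powr (k - 1) * norm (?a n (i+1)))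
        \<le> K * (\<alpha> i * \<phi> i powr (k - 1))"
      using A unfolding class_S_def by blast
  qed (use nonneg in auto)
  then obtain K4 where K4: "K4 \<ge> 0"
    "\<And>i. (\<Sum>\<^sub>\<infinity>n\<in>{i+1..}. \<alpha> n * \<phi> n powr (k - 1) * norm (?a n (i+1)))
      \<le> K4 * (\<alpha> i * \<phi> i powr (k - 1))"
    by blast
  have "\<exists>K\<ge>0. \<forall>n. (\<Sum>v\<le>n. norm (?a n (v + 1)) * \<phi> v) \<le> K * \<phi> n"
    by (rule bound) (use row nonneg in \<open>auto simp: norm_mult\<close>)
  then obtain K5 where K5: "K5 \<ge> 0" "\<And>n. (\<Sum>v\<le>n. norm (?a n (v + 1)) * \<phi> v) \<le> K5 * \<phi> n"
    by blast
  have "\<exists>K\<ge>0. \<forall>n. n \<ge> 1 \<longrightarrow> norm (lam (Suc n)) \<le> K * norm (lam n)"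
    by (rule nonneg_bound_constant) (use lam_Suc in auto)
  then obtain D where D: "D \<ge> 0" "\<And>n. n \<ge> 1 \<Longrightarrow> norm (lam (Suc n)) \<le> D * norm (lam n)"
    by blast
  have "\<exists>K\<ge>0. \<forall>n. n \<ge> 1 \<longrightarrow> \<bar>fdiff X n\<bar> \<le> K * (1 / real n)"
    by (rule nonneg_bound_constant) (use diff_X in auto)
  then obtain E where E: "E \<ge> 0" "\<And>n. n \<ge> 1 \<Longrightarrow> \<bar>fdiff X n\<bar> \<le> E * (1 / real n)"
    by blast
  have dX: "\<bar>fdiff X n\<bar> \<le> E * (\<phi> n * X n)" if "n \<ge> 1" for n
    using E(2)[OF that] X[OF that] \<phi>[of n] by simp
  define V where "V = (\<Sum>\<^sub>\<infinity>r\<in>{1..}. norm (fdiff lam r))"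
  have V: "V \<ge> 0" unfolding V_def by (rule infsum_nonneg) auto

  have sum_A': "(\<lambda>r. \<alpha> r * \<phi> r powr k * (norm (lam r) * X r) powr k) summable_on UNIV"
    using sum_A nonneg by (simp add: powr_mult mult_ac)
  have first: "weighted_lk \<alpha> k (\<lambda>n. \<Sum>r\<in>{1..<n}. norm (fdiff (?a n) r) * (norm (lam r) * X r))"
  proof (rule weighted_lk_row_sums[where \<phi> = \<phi> and B = K1 and L = K3
        and c = "\<lambda>r. \<alpha> r * \<phi> r powr k"])
    fix n
    have "(\<Sum>r\<in>{1..<n}. norm (fdiff (?a n) r)) \<le> (\<Sum>r<n. norm (fdiff (?a n) r))"
      by (intro sum_mono2) auto
    then show "(\<Sum>r\<in>{1..<n}. norm (fdiff (?a n) r)) \<le> K1 * \<phi> n"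
      using K1(2)[of n] by simp
  qed (use k nonneg K1 K3 T3_summable sum_A' in auto)

  have second: "weighted_lk \<alpha> k
      (\<lambda>n. \<Sum>r\<in>{1..<n}. norm (?a n (r + 1)) * norm (fdiff lam r) * X r)"
  proof (rule weighted_lk_row_sums[where \<phi> = \<phi> and B = "K2 * V" and L = K4
        and c = "\<lambda>r. \<alpha> r * \<phi> r powr (k - 1) * norm (fdiff lam r)"])
    fix n
    have "(\<Sum>r\<in>{1..<n}. norm (?a n (r + 1)) * norm (fdiff lam r))
        \<le> (\<Sum>r\<in>{1..<n}. K2 * \<phi> n * norm (fdiff lam r))"
      by (intro sum_mono mult_right_mono K2(2)) auto
    also have "\<dots> = K2 * \<phi> n * (\<Sum>r\<in>{1..<n}. norm (fdiff lam r))"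
      by (simp add: sum_distrib_left)
    also have "\<dots> \<le> K2 * \<phi> n * V"
      unfolding V_def using K2(1) nonneg
      by (intro mult_left_mono finite_sum_le_infsum[OF bv]) auto
    finally show "(\<Sum>r\<in>{1..<n}. norm (?a n (r + 1)) * norm (fdiff lam r)) \<le> K2 * V * \<phi> n"
      by (simp add: mult_ac)
  next
    fix r
    have reorder: "\<alpha> n * \<phi> n powr (k - 1) * (norm (?a n (r + 1)) * norm (fdiff lam r))
        = \<alpha> n * \<phi> n powr (k - 1) * norm (?a n (r + 1)) * norm (fdiff lam r)" for n
      by simp
    show "(\<lambda>n. \<alpha> n * \<phi> n powr (k - 1) * (norm (?a n (r + 1)) * norm (fdiff lam r)))
        summable_on {r+1..}"
      unfolding reorder by (rule summable_on_cmult_left[OF T4_summable])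
    show "(\<Sum>\<^sub>\<infinity>n\<in>{r+1..}. \<alpha> n * \<phi> n powr (k - 1) * (norm (?a n (r + 1)) * norm (fdiff lam r)))
        \<le> K4 * (\<alpha> r * \<phi> r powr (k - 1) * norm (fdiff lam r))"
      unfolding reorder infsum_cmult_left[OF T4_summable]
      using mult_right_mono[OF K4(2)[of r], of "norm (fdiff lam r)"]
      by (simp add: mult_ac)
  qed (use k nonneg K2 K4 V sum_B in \<open>auto simp: mult_ac\<close>)

  have third: "weighted_lk \<alpha> k
      (\<lambda>n. \<Sum>r\<in>{1..<n}. norm (?a n (r + 1)) * \<phi> r * (norm (lam r) * X r))"
  proof (rule weighted_lk_row_sums[where \<phi> = \<phi> and B = K5 and L = K4
        and c = "\<lambda>r. \<alpha> r * \<phi> r powr k"])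
    fix n
    have "(\<Sum>r\<in>{1..<n}. norm (?a n (r + 1)) * \<phi> r) \<le> (\<Sum>r\<le>n. norm (?a n (r + 1)) * \<phi> r)"
      using nonneg by (intro sum_mono2) auto
    then show "(\<Sum>r\<in>{1..<n}. norm (?a n (r + 1)) * \<phi> r) \<le> K5 * \<phi> n"
      using K5(2)[of n] by simp
  next
    fix r
    have reorder: "\<alpha> n * \<phi> n powr (k - 1) * (norm (?a n (r + 1)) * \<phi> r)
        = \<alpha> n * \<phi> n powr (k - 1) * norm (?a n (r + 1)) * \<phi> r" for n
      by simp
    show "(\<lambda>n. \<alpha> n * \<phi> n powr (k - 1) * (norm (?a n (r + 1)) * \<phi> r)) summable_on {r+1..}"
      unfolding reorder by (rule summable_on_cmult_left[OF T4_summable])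
    have "\<phi> r powr k = \<phi> r powr (k - 1) * \<phi> r"
      using \<phi>[of r] by (simp add: powr_diff)
    then show "(\<Sum>\<^sub>\<infinity>n\<in>{r+1..}. \<alpha> n * \<phi> n powr (k - 1) * (norm (?a n (r + 1)) * \<phi> r))
        \<le> K4 * (\<alpha> r * \<phi> r powr k)"
      unfolding reorder infsum_cmult_left[OF T4_summable]
      using mult_right_mono[OF K4(2)[of r], of "\<phi> r"] nonneg
      by (simp add: mult_ac)
  qed (use k nonneg K5 K4 sum_A' in auto)

  have "weighted_lk \<alpha> k (\<lambda>n. \<phi> n * (norm (lam n) * X n))"
    unfolding weighted_lk_def
    using summable_on_subset_banach[OF sum_A', of "{1..}"] nonneg
    by (simp add: powr_mult mult_ac)
  then have "weighted_lk \<alpha> k (\<lambda>n. K2 * (\<phi> n * (norm (lam n) * X n)))"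
    using K2(1) nonneg by (intro weighted_lk_cmult) auto
  then have diagonal: "weighted_lk \<alpha> k (\<lambda>n. norm (?a n n) * (norm (lam n) * X n))"
  proof (rule weighted_lk_mono)
    fix n
    show "norm (?a n n) * (norm (lam n) * X n) \<le> K2 * (\<phi> n * (norm (lam n) * X n))"
      using mult_right_mono[OF K2(2)[of n n], of "norm (lam n) * X n"] nonneg
      by (simp add: mult_ac)
  qed (use k nonneg in auto)

  have M: "M \<ge> 0" using c norm_ge_zero order_trans by blast
  have "weighted_lk \<alpha> k (\<lambda>n. M * ((\<Sum>r\<in>{1..<n}. norm (fdiff (?a n) r) * (norm (lam r) * X r))
          + (\<Sum>r\<in>{1..<n}. norm (?a n (r + 1)) * norm (fdiff lam r) * X r)
          + D * E * (\<Sum>r\<in>{1..<n}. norm (?a n (r + 1)) * \<phi> r * (norm (lam r) * X r))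
          + norm (?a n n) * (norm (lam n) * X n)))"
    using k nonneg M D(1) E(1)
    by (intro weighted_lk_cmult weighted_lk_add first second third diagonal
        add_nonneg_nonneg mult_nonneg_nonneg sum_nonneg) auto
  then show ?thesis
    unfolding abs_mat_summable_iff_weighted_lk
  proof (rule weighted_lk_mono)
    fix n :: nat assume n: "n \<ge> 1"
    show "norm (mat_mean A (\<lambda>n. c n * lam n * of_real (X n)) n
          - mat_mean A (\<lambda>n. c n * lam n * of_real (X n)) (n - 1))
      \<le> M * ((\<Sum>r\<in>{1..<n}. norm (fdiff (?a n) r) * (norm (lam r) * X r))
          + (\<Sum>r\<in>{1..<n}. norm (?a n (r + 1)) * norm (fdiff lam r) * X r)
          + D * E * (\<Sum>r\<in>{1..<n}. norm (?a n (r + 1)) * \<phi> r * (norm (lam r) * X r))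
          + norm (?a n n) * (norm (lam n) * X n))"
      unfolding mat_mean_diff_eq_hat[OF n]
      by (rule norm_factored_sum_le[where x = X and l = lam]) (use n D E(1) nonneg(3) c dX in auto)
  qed (use k nonneg in auto)
qed

section \<open>Localisation of Fourier partial sums\<close>

text \<open>
  Multiplied by \<open>2 * sin (u / 2)\<close>, the sum telescopes to a difference of two sines.
\<close>

lemma sum_cos_bound:
  assumes "sin (u / 2) \<noteq> 0"
  shows "\<bar>\<Sum>r = 1..n. cos (real r * u)\<bar> \<le> 1 / \<bar>sin (u / 2)\<bar>"
proof -
  have closed: "2 * sin (u / 2) * (\<Sum>r = 1..n. cos (real r * u))
      = sin (real n * u + u / 2) - sin (u / 2)"
  proof (induction n)
    case 0
    then show ?case by simp
  next
    case (Suc n)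
    have args: "real (Suc n) * u - u / 2 = real n * u + u / 2"
      by (simp add: field_simps)
    have "2 * sin (u / 2) * cos (real (Suc n) * u)
        = sin (real (Suc n) * u + u / 2) - sin (real n * u + u / 2)"
      unfolding args[symmetric]
      using cos_times_sin[of "real (Suc n) * u" "u / 2"] by (simp add: mult_ac)
    with Suc show ?case by (simp add: ring_distribs)
  qed
  have "2 * \<bar>sin (u / 2)\<bar> * \<bar>\<Sum>r = 1..n. cos (real r * u)\<bar> = \<bar>sin (real n * u + u / 2) - sin (u / 2)\<bar>"
    using closed by (metis abs_mult abs_numeral)
  also have "\<dots> \<le> 2"
    using abs_sin_le_one[of "real n * u + u / 2"] abs_sin_le_one[of "u / 2"] by linarith
  finally show ?thesis using assms by (simp add: field_simps)
qed

text \<open>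
  Subtracting a multiple of \<open>2 * pi\<close> from \<open>t - x\<close> to reach \<open>v\<close> with \<open>|v| \<le> pi\<close> changes at most the sign
  of \<open>sin ((t - x) / 2)\<close>, and \<open>sin (|v| / 2)\<close> is increasing in \<open>|v|\<close> on that range.
\<close>

lemma periodic_zero_near_or_sin_ge:
  fixes h :: "real \<Rightarrow> 'a::zero"
  assumes per: "\<And>t. h (t + 2 * pi) = h t"
    and "0 < d" "d \<le> pi" and zero: "\<And>t. \<bar>t - x\<bar> < d \<Longrightarrow> h t = 0"
  shows "h t = 0 \<or> sin (d / 2) \<le> \<bar>sin ((t - x) / 2)\<bar>"
proof -
  have per_int: "h (s + 2 * pi * of_int m) = h s" for s and m :: int
  proof (induction m arbitrary: s rule: int_induct[where k = 0])
    case base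
    then show ?case by simp
  next
    case (step1 i)
    show ?case
      using per[of "s + 2 * pi * of_int i"] step1.IH[of s] by (simp add: algebra_simps)
  next
    case (step2 i)
    show ?case
      using per[of "s + 2 * pi * of_int (i - 1)"] step2.IH[of s] by (simp add: algebra_simps)
  qed
  define m where "m = round ((t - x) / (2 * pi))"
  define v where "v = (t - x) - 2 * pi * of_int m"
  have "\<bar>of_int m - (t - x) / (2 * pi)\<bar> \<le> 1 / 2"
    unfolding m_def by (rule of_int_round_abs_le)
  then have "2 * pi * \<bar>of_int m - (t - x) / (2 * pi)\<bar> \<le> 2 * pi * (1 / 2)"
    by (intro mult_left_mono) auto
  moreover have "2 * pi * \<bar>of_int m - (t - x) / (2 * pi)\<bar> = \<bar>v\<bar>"
  proof -
    have "2 * pi * (of_int m - (t - x) / (2 * pi)) = - v"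
      by (simp add: v_def field_simps)
    then show ?thesis
      by (metis abs_minus_cancel abs_mult abs_of_pos mult_pos_pos pi_gt_zero zero_less_numeral)
  qed
  ultimately have v_le: "\<bar>v\<bar> \<le> pi" by simp
  have h_v: "h t = h (x + v)"
    using per_int[of "x + v" m] by (simp add: v_def)
  show ?thesis
  proof (cases "\<bar>v\<bar> < d")
    case True
    then show ?thesis using zero[of "x + v"] h_v by simp
  next
    case False
    have half: "(t - x) / 2 = v / 2 + of_int m * pi"
      by (simp add: v_def field_simps)
    have sin_0: "sin (of_int m * pi) = 0" by (simp add: sin_times_pi_eq_0)
    then have "\<bar>cos (of_int m * pi)\<bar> = 1" by (rule sin_zero_abs_cos_one)
    then have "\<bar>sin ((t - x) / 2)\<bar> = \<bar>sin (v / 2)\<bar>"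
      unfolding half sin_add sin_0 by (simp add: abs_mult)
    also have "\<dots> = sin (\<bar>v\<bar> / 2)"
    proof -
      have "sin (\<bar>v\<bar> / 2) \<ge> 0" using v_le by (intro sin_ge_zero) auto
      then show ?thesis by (cases "v \<ge> 0") auto
    qed
    finally have "\<bar>sin ((t - x) / 2)\<bar> = sin (\<bar>v\<bar> / 2)" .
    moreover have "sin (d / 2) \<le> sin (\<bar>v\<bar> / 2)"
      using False v_le assms by (intro sin_monotone_2pi_le) auto
    ultimately show ?thesis by simp
  qed
qed

lemma set_integrable_mult_bounded_continuous:
  fixes f :: "real \<Rightarrow> complex" and g :: "real \<Rightarrow> real"
  assumes "set_integrable lebesgue S f" "continuous_on UNIV g" "\<And>t. \<bar>g t\<bar> \<le> B"
  shows "set_integrable lebesgue S (\<lambda>t. f t * of_real (g t))"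
proof -
  have "g \<in> borel_measurable lebesgue"
    using borel_measurable_continuous_onI[OF assms(2)] by (simp add: measurable_completion)
  then have meas: "(\<lambda>t. (indicator S t *\<^sub>R f t) * complex_of_real (g t)) \<in> borel_measurable lebesgue"
    using assms(1) by (intro borel_measurable_times borel_measurable_of_real)
      (auto simp: set_integrable_def)
  have "integrable lebesgue (\<lambda>t. B *\<^sub>R (indicator S t *\<^sub>R f t))"
    using assms(1) unfolding set_integrable_def by (intro integrable_scaleR_right)
  then have "integrable lebesgue (\<lambda>t. (indicator S t *\<^sub>R f t) * complex_of_real (g t))"
  proof (rule Bochner_Integration.integrable_bound[OF _ meas], intro AE_I2)
    fix t
    have "\<bar>g t\<bar> \<le> \<bar>B\<bar>" using assms(3)[of t] by simp
    then show "norm ((indicator S t *\<^sub>R f t) * complex_of_real (g t))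
        \<le> norm (B *\<^sub>R (indicator S t *\<^sub>R f t))"
      by (cases "t \<in> S") (auto simp: norm_mult mult.commute[of _ "norm (f t)"] intro: mult_left_mono)
  qed
  then show ?thesis by (simp add: set_integrable_def)
qed

lemma fourier_term_eq_integral:
  assumes "set_integrable lebesgue {-pi<..<pi} f"
  shows "fourier_term f n x = of_real (1 / pi) *
    (LINT t:{-pi<..<pi}|lebesgue. f t * of_real (cos (real n * (t - x))))"
proof -
  have int: "set_integrable lebesgue {-pi<..<pi} (\<lambda>t. f t * of_real (cos (real n * t)))"
    "set_integrable lebesgue {-pi<..<pi} (\<lambda>t. f t * of_real (sin (real n * t)))"
    by (rule set_integrable_mult_bounded_continuous[OF assms, where B = 1];
        auto intro!: continuous_intros)+
  have "(LINT t:{-pi<..<pi}|lebesgue. f t * of_real (cos (real n * (t - x))))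
      = (LINT t:{-pi<..<pi}|lebesgue. f t * of_real (cos (real n * t)) * of_real (cos (real n * x))
          + f t * of_real (sin (real n * t)) * of_real (sin (real n * x)))"
    by (simp add: right_diff_distrib cos_diff algebra_simps)
  also have "\<dots> = (LINT t:{-pi<..<pi}|lebesgue. f t * of_real (cos (real n * t))) * of_real (cos (real n * x))
      + (LINT t:{-pi<..<pi}|lebesgue. f t * of_real (sin (real n * t))) * of_real (sin (real n * x))"
    using int by (subst set_integral_add) auto
  finally show ?thesis
    by (simp add: fourier_term_def fourier_cos_coeff_def fourier_sin_coeff_def algebra_simps)
qed

text \<open>
  The boundedness part of Riemann's localisation principle: where \<open>h\<close> does not
  vanish, the distance of \<open>t - x\<close> from the multiples of \<open>2 * pi\<close> is bounded below, hence so is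
  \<open>|sin ((t - x) / 2)|\<close>, and the kernels \<open>\<Sum> cos (r * (t - x))\<close> are bounded uniformly in their length.
\<close>

lemma fourier_partial_sums_bounded:
  fixes h :: "real \<Rightarrow> complex"
  assumes per: "\<And>t. h (t + 2 * pi) = h t"
    and int: "set_integrable lebesgue {-pi<..<pi} h"
    and zero: "\<forall>\<^sub>F t in nhds x. h t = 0"
  shows "\<exists>M. \<forall>n. norm (\<Sum>r = 1..n. fourier_term h r x) \<le> M"
proof -
  let ?I = "{-pi<..<pi} :: real set"
  obtain d0 where d0: "d0 > 0" "\<And>t. \<bar>t - x\<bar> < d0 \<Longrightarrow> h t = 0"
    using zero unfolding eventually_nhds_metric by (auto simp: dist_real_def)
  define d where "d = min d0 pi"
  have d: "0 < d" "d \<le> pi" "\<And>t. \<bar>t - x\<bar> < d \<Longrightarrow> h t = 0"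
    using d0 by (auto simp: d_def)
  define \<sigma> where "\<sigma> = sin (d / 2)"
  have \<sigma>: "\<sigma> > 0" unfolding \<sigma>_def using d by (intro sin_gt_zero) auto
  define S where "S n t = (\<Sum>r = 1..n. cos (real r * (t - x)))" for n t
  have S_cont: "continuous_on UNIV (S n)" for n
    unfolding S_def by (intro continuous_intros)
  have S_bound: "\<bar>S n t\<bar> \<le> real n" for n t
  proof -
    have "\<bar>S n t\<bar> \<le> (\<Sum>r = 1..n. \<bar>cos (real r * (t - x))\<bar>)"
      unfolding S_def by (rule sum_abs)
    also have "\<dots> \<le> (\<Sum>r = 1..n. 1)"
      by (intro sum_mono) auto
    finally show ?thesis by simp
  qed
  have S_int: "set_integrable lebesgue ?I (\<lambda>t. h t * of_real (S n t))" for n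
    by (rule set_integrable_mult_bounded_continuous[OF int S_cont S_bound])
  have partial: "(\<Sum>r = 1..n. fourier_term h r x)
      = of_real (1 / pi) * (LINT t:?I|lebesgue. h t * of_real (S n t))" for n
  proof (induction n)
    case 0
    then show ?case by (simp add: S_def set_lebesgue_integral_def)
  next
    case (Suc n)
    have cos_int: "set_integrable lebesgue ?I (\<lambda>t. h t * of_real (cos (real (Suc n) * (t - x))))"
      by (rule set_integrable_mult_bounded_continuous[OF int, where B = 1])
        (auto intro!: continuous_intros)
    have S_Suc: "h t * of_real (S (Suc n) t)
        = h t * of_real (S n t) + h t * of_real (cos (real (Suc n) * (t - x)))" for t
      by (simp add: S_def ring_distribs)
    have "(LINT t:?I|lebesgue. h t * of_real (S (Suc n) t)) = (LINT t:?I|lebesgue. h t * of_real (S n t))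
        + (LINT t:?I|lebesgue. h t * of_real (cos (real (Suc n) * (t - x))))"
      unfolding S_Suc by (rule set_integral_add(2)[OF S_int cos_int])
    then show ?case
      using Suc fourier_term_eq_integral[OF int, of "Suc n" x]
      by (simp add: distrib_left)
  qed
  have kernel: "norm (h t * of_real (S n t)) \<le> norm (h t) * (1 / \<sigma>)" for n t
  proof (cases "h t = 0")
    case False
    then have \<sigma>_le: "\<sigma> \<le> \<bar>sin ((t - x) / 2)\<bar>"
      using periodic_zero_near_or_sin_ge[of h d x t] per d by (auto simp: \<sigma>_def)
    then have "\<bar>S n t\<bar> \<le> 1 / \<bar>sin ((t - x) / 2)\<bar>"
      unfolding S_def using \<sigma> by (intro sum_cos_bound) auto
    also have "\<dots> \<le> 1 / \<sigma>" using \<sigma> \<sigma>_le by (intro divide_left_mono) auto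
    finally have "norm (h t) * \<bar>S n t\<bar> \<le> norm (h t) * (1 / \<sigma>)"
      by (intro mult_left_mono) auto
    then show ?thesis by (simp add: norm_mult)
  qed simp
  have norm_int: "set_integrable lebesgue ?I (\<lambda>t. norm (h t) * (1 / \<sigma>))"
    using set_integrable_norm[OF int] by auto
  have "norm (\<Sum>r = 1..n. fourier_term h r x)
      \<le> 1 / pi * (LINT t:?I|lebesgue. norm (h t) * (1 / \<sigma>))" for n
  proof -
    have "norm (LINT t:?I|lebesgue. h t * of_real (S n t))
        \<le> (LINT t:?I|lebesgue. norm (h t * of_real (S n t)))"
      by (rule set_integral_norm_bound[OF S_int])
    also have "\<dots> \<le> (LINT t:?I|lebesgue. norm (h t) * (1 / \<sigma>))"
      by (intro set_integral_mono kernel norm_int set_integrable_norm S_int)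
    finally have "1 / pi * norm (LINT t:?I|lebesgue. h t * of_real (S n t))
        \<le> 1 / pi * (LINT t:?I|lebesgue. norm (h t) * (1 / \<sigma>))"
      by (rule mult_left_mono) auto
    then show ?thesis
      unfolding partial norm_mult by (simp add: norm_divide)
  qed
  then show ?thesis by blast
qed

lemma fourier_term_diff:
  assumes "set_integrable lebesgue {-pi<..<pi} f" "set_integrable lebesgue {-pi<..<pi} g"
  shows "fourier_term (\<lambda>t. f t - g t) n x = fourier_term f n x - fourier_term g n x"
proof -
  have int: "set_integrable lebesgue {-pi<..<pi} (\<lambda>t. h t * of_real (cos (real n * (t - x))))"
    if "set_integrable lebesgue {-pi<..<pi} h" for h :: "real \<Rightarrow> complex"
    by (rule set_integrable_mult_bounded_continuous[OF that, where B = 1])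
      (auto intro!: continuous_intros)
  show ?thesis
    using assms int[OF assms(1)] int[OF assms(2)]
    by (simp add: fourier_term_eq_integral left_diff_distrib right_diff_distrib set_integral_diff)
qed

section \<open>The local property\<close>

theorem theorem2:
  fixes k :: real
    and \<alpha> \<phi> X :: "nat \<Rightarrow> real"
    and A :: "nat \<Rightarrow> nat \<Rightarrow> complex"
    and lam :: "nat \<Rightarrow> complex"
  assumes "k \<ge> 1"
    and "\<And>n. \<alpha> n > 0"
    and "\<And>n. \<phi> n > 0"
    and "X 0 = 0"
    and "\<And>n. n \<ge> 1 \<Longrightarrow> X n = 1 / (real n * \<phi> n)"
    and "A \<in> class_S k \<alpha> \<phi>"
    and "(\<lambda>n. norm (fdiff lam n)) summable_on {1..}"
    and "\<exists>K. \<forall>n\<ge>1. norm (lam (n + 1)) \<le> K * norm (lam n)"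
    and "(\<lambda>n. \<alpha> n * \<phi> n powr k * X n powr k * norm (lam n) powr k) summable_on UNIV"
    and "(\<lambda>n. \<alpha> n * \<phi> n powr (k - 1) * X n powr k * norm (fdiff lam n)) summable_on UNIV"
    and "\<exists>K. \<forall>n. (\<Sum>v\<le>n. norm (mat_hat A n (v + 1) * of_real (\<phi> v))) \<le> K * \<phi> n"
    and "\<exists>K. \<forall>n\<ge>1. \<bar>fdiff X n\<bar> \<le> K * (1 / real n)"
  shows "\<forall>x. local_property_at
           (\<lambda>f. abs_mat_summable A \<alpha> k (\<lambda>n. fourier_term f n x * lam n * of_real (X n))) x"
proof (intro allI)
  fix x :: real
  let ?u = "\<lambda>f n. fourier_term f n x * lam n * of_real (X n)"
  have transfer: "abs_mat_summable A \<alpha> k (?u f)"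
    if g: "abs_mat_summable A \<alpha> k (?u g)"
      and "periodic_mean_zero f" "periodic_mean_zero g" and eq: "\<forall>\<^sub>F t in nhds x. f t = g t"
    for f g
  proof -
    let ?h = "\<lambda>t. f t - g t"
    have f_g: "\<And>t. f (t + 2 * pi) = f t" "\<And>t. g (t + 2 * pi) = g t"
      "set_integrable lebesgue {-pi<..<pi} f" "set_integrable lebesgue {-pi<..<pi} g"
      using that by (auto simp: periodic_mean_zero_def)
    have "\<forall>\<^sub>F t in nhds x. ?h t = 0"
      using eq by eventually_elim simp
    then obtain M where M: "\<And>n. norm (\<Sum>r = 1..n. fourier_term ?h r x) \<le> M"
      using fourier_partial_sums_bounded[of ?h x] f_g by auto
    have "abs_mat_summable A \<alpha> k (?u ?h)"
      by (rule abs_mat_summable_of_bounded_partial_sums[OF assms M])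
    then have "abs_mat_summable A \<alpha> k (\<lambda>n. ?u g n + ?u ?h n)"
      using g assms(1) less_imp_le[OF assms(2)] by (intro abs_mat_summable_add) auto
    moreover have "?u g n + ?u ?h n = ?u f n" for n
      using f_g by (simp add: fourier_term_diff algebra_simps)
    ultimately show ?thesis by simp
  qed
  show "local_property_at (\<lambda>f. abs_mat_summable A \<alpha> k (?u f)) x"
    unfolding local_property_at_def
  proof (intro allI impI iffI)
    fix f g
    assume f: "periodic_mean_zero f" and g: "periodic_mean_zero g"
      and eq: "\<forall>\<^sub>F t in nhds x. f t = g t"
    show "abs_mat_summable A \<alpha> k (?u g)" if "abs_mat_summable A \<alpha> k (?u f)"
      using that g f
    proof (rule transfer)
      show "\<forall>\<^sub>F t in nhds x. g t = f t" using eq by eventually_elim simp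
    qed
    show "abs_mat_summable A \<alpha> k (?u f)" if "abs_mat_summable A \<alpha> k (?u g)"
      using that f g eq by (rule transfer)
  qed
qed

end
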